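(* Let $(X,\mathcal{B},\mu,T)$ be an MDS and let $\alpha\in\mathcal{P}_X$ be a finite measurable partition. Then $$\underline{D}^e_\mu(T,\alpha)\le \overline{D}^e_\mu(T,\alpha)= \underline{D}^p_\mu(T,\alpha)\le \overline{D}^p_\mu(T,\alpha).$$
   Context: An MDS (measure-theoretical dynamical system) $(X,\mathcal{B},\mu,T)$ is a probability space $(X,\mathcal{B},\mu)$ with a measurable $\mu$-preserving map $T:X\to X$. $\mathcal{P}_X$ is the collection of finite measurable partitions of $X$; $H_\mu$ is Shannon entropy; $\mathbb{N}=\{1,2,\dots\}$. Dimension of a sequence. For an increasing sequence $S=\{s_1<s_2<\cdots\}\subset\mathbb{N}$ and $\tau\ge 0$ put $\overline{D}(S,\tau)=\limsup_{n\to\infty} n/(s_n)^\tau$ and $\underline{D}(S,\tau)=\liminf_{n\to\infty} n/(s_n)^\tau$. The upper dimension of $S$ is $\overline{D}(S)=\inf\{\tau\ge0:\overline{D}(S,\tau)=0\}=\sup\{\tau\ge0:\overline{D}(S,\tau)=\infty\}$ and the lower dimension is $\underline{D}(S)=\inf\{\tau\ge0:\underline{D}(S,\tau)=0\}=\sup\{\tau\ge0:\underline{D}(S,\tau)=\infty\}$. For $\alpha\in\mathcal{P}_X$, $\mathcal{E}_\mu(T,\alpha)$ is the set of entropy generating sequences of $\alpha$: those $S=\{s_1<s_2<\cdots\}\subset\mathbb{N}$ with $\liminf_{n\to\infty}\frac1n H_\mu(\bigvee_{i=1}^n T^{-s_i}\alpha)>0$. $\mathcal{P}_\mu(T,\alpha)$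 is the set of positive entropy sequences of $\alpha$: those $S$ with $\limsup_{n\to\infty}\frac1n H_\mu(\bigvee_{i=1}^n T^{-s_i}\alpha)>0$. Define $\overline{D}^e_\mu(T,\alpha)=\sup_{S\in\mathcal{E}_\mu(T,\alpha)}\overline{D}(S)$, $\underline{D}^e_\mu(T,\alpha)=\sup_{S\in\mathcal{E}_\mu(T,\alpha)}\underline{D}(S)$, $\overline{D}^p_\mu(T,\alpha)=\sup_{S\in\mathcal{P}_\mu(T,\alpha)}\overline{D}(S)$, $\underline{D}^p_\mu(T,\alpha)=\sup_{S\in\mathcal{P}_\mu(T,\alpha)}\underline{D}(S)$, where a supremum over the empty set is $0$. *)

theory Defs
  imports "HOL-Probability.Probability"
begin

locale mds = prob_space M for M :: "'a measure" +
  fixes T :: "'a \<Rightarrow> 'a"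
  assumes T_measurable: "T \<in> M \<rightarrow>\<^sub>M M"
    and T_preserving: "\<And>A. A \<in> sets M \<Longrightarrow> emeasure M (T -` A \<inter> space M) = emeasure M A"

definition fin_meas_partitions :: "'a measure \<Rightarrow> 'a set set set"
  where "fin_meas_partitions M = {\<alpha>. partition_on (space M) \<alpha> \<and> finite \<alpha> \<and> \<alpha> \<subseteq> sets M}"

text \<open>Since \<open>ln 0 = 0\<close> in HOL, null cells contribute \<open>0\<close>, as usual.\<close>
definition partition_entropy :: "'a measure \<Rightarrow> 'a set set \<Rightarrow> real"
  where "partition_entropy M \<alpha> = - (\<Sum>A\<in>\<alpha>. measure M A * ln (measure M A))"

text \<open>Empty preimages are dropped so that the result is again a partition in the sense of
  \<^const>\<open>partition_on\<close>.\<close>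
definition pullback :: "'a measure \<Rightarrow> ('a \<Rightarrow> 'a) \<Rightarrow> 'a set set \<Rightarrow> 'a set set"
  where "pullback M f \<alpha> = (\<lambda>A. f -` A \<inter> space M) ` \<alpha> - {{}}"

text \<open>A set \<open>{s\<^sub>1 < s\<^sub>2 < \<dots>}\<close> of positive integers is represented by its increasing enumeration
  \<open>s\<close>, indexed from \<open>1\<close>; the value \<open>s 0\<close> is irrelevant everywhere below.\<close>
definition inc_seqs :: "(nat \<Rightarrow> nat) set"
  where "inc_seqs = {s. strict_mono_on {1..} s \<and> (\<forall>n\<ge>1. 1 \<le> s n)}"

definition upper_D :: "(nat \<Rightarrow> nat) \<Rightarrow> real \<Rightarrow> ereal"
  where "upper_D s \<tau> = limsup (\<lambda>n. ereal (real n / real (s n) powr \<tau>))"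

definition lower_D :: "(nat \<Rightarrow> nat) \<Rightarrow> real \<Rightarrow> ereal"
  where "lower_D s \<tau> = liminf (\<lambda>n. ereal (real n / real (s n) powr \<tau>))"

text \<open>The descriptions of the dimensions as suprema are
  \<open>upper_dim_eq_SUP\<close> and \<open>lower_dim_eq_SUP\<close> below.\<close>
definition upper_dim :: "(nat \<Rightarrow> nat) \<Rightarrow> ereal"
  where "upper_dim s = (INF \<tau>\<in>{\<tau>. 0 \<le> \<tau> \<and> upper_D s \<tau> = 0}. ereal \<tau>)"

definition lower_dim :: "(nat \<Rightarrow> nat) \<Rightarrow> ereal"
  where "lower_dim s = (INF \<tau>\<in>{\<tau>. 0 \<le> \<tau> \<and> lower_D s \<tau> = 0}. ereal \<tau>)"

definition join_along :: "'a measure \<Rightarrow> ('a \<Rightarrow> 'a) \<Rightarrow> 'a set set \<Rightarrow> (nat \<Rightarrow> nat) \<Rightarrow> nat \<Rightarrow> 'a set set"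
  where "join_along M T \<alpha> s n = common_refinement ((\<lambda>i. pullback M (T ^^ s i) \<alpha>) ` {1..n})"

definition entropy_gen_seqs :: "'a measure \<Rightarrow> ('a \<Rightarrow> 'a) \<Rightarrow> 'a set set \<Rightarrow> (nat \<Rightarrow> nat) set"
  where "entropy_gen_seqs M T \<alpha> = {s \<in> inc_seqs.
    liminf (\<lambda>n. ereal (1 / real n * partition_entropy M (join_along M T \<alpha> s n))) > 0}"

definition pos_entropy_seqs :: "'a measure \<Rightarrow> ('a \<Rightarrow> 'a) \<Rightarrow> 'a set set \<Rightarrow> (nat \<Rightarrow> nat) set"
  where "pos_entropy_seqs M T \<alpha> = {s \<in> inc_seqs.
    limsup (\<lambda>n. ereal (1 / real n * partition_entropy M (join_along M T \<alpha> s n))) > 0}"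

text \<open>Supremum with the convention that it is \<open>0\<close> over the empty set (in \<^typ>\<open>ereal\<close> it would
  be \<open>-\<infinity>\<close>).\<close>
definition Sup0 :: "ereal set \<Rightarrow> ereal"
  where "Sup0 A = (if A = {} then 0 else Sup A)"

definition upper_De :: "'a measure \<Rightarrow> ('a \<Rightarrow> 'a) \<Rightarrow> 'a set set \<Rightarrow> ereal"
  where "upper_De M T \<alpha> = Sup0 (upper_dim ` entropy_gen_seqs M T \<alpha>)"

definition lower_De :: "'a measure \<Rightarrow> ('a \<Rightarrow> 'a) \<Rightarrow> 'a set set \<Rightarrow> ereal"
  where "lower_De M T \<alpha> = Sup0 (lower_dim ` entropy_gen_seqs M T \<alpha>)"

definition upper_Dp :: "'a measure \<Rightarrow> ('a \<Rightarrow> 'a) \<Rightarrow> 'a set set \<Rightarrow> ereal"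
  where "upper_Dp M T \<alpha> = Sup0 (upper_dim ` pos_entropy_seqs M T \<alpha>)"

definition lower_Dp :: "'a measure \<Rightarrow> ('a \<Rightarrow> 'a) \<Rightarrow> 'a set set \<Rightarrow> ereal"
  where "lower_Dp M T \<alpha> = Sup0 (lower_dim ` pos_entropy_seqs M T \<alpha>)"


subsection \<open>The dimensions as suprema\<close>

lemma inc_seqs_ge: 
  assumes "s \<in> inc_seqs" shows "n \<le> s n"
proof (induction n)
  case (Suc n)
  show ?case
  proof (cases "n = 0")
    case True then show ?thesis using assms by (auto simp: inc_seqs_def)
  next
    case False
    then have "s n < s (Suc n)" 
      using assms by (auto simp: inc_seqs_def intro: strict_mono_onD)
    then show ?thesis using Suc by simp
  qed
qed simp

lemma inc_seqs_quot_tendsto_0: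
  assumes s: "s \<in> inc_seqs" and "\<tau> < \<tau>'"
  shows "(\<lambda>n. real (s n) powr (\<tau> - \<tau>')) \<longlonglongrightarrow> 0"
proof -
  have "filterlim (\<lambda>n. real (s n)) at_top sequentially"
    using inc_seqs_ge[OF s]
    by (intro filterlim_at_top_mono[OF filterlim_real_sequentially]) auto
  with assms(2) show ?thesis
    by (intro tendsto_neg_powr) auto
qed

lemma inc_seqs_quot_split:
  assumes s: "s \<in> inc_seqs"
  shows "real n / real (s n) powr \<tau>' = 
    real (s n) powr (\<tau> - \<tau>') * (real n / real (s n) powr \<tau>)"
proof (cases "n = 0")
  case False
  then have "s n > 0" using inc_seqs_ge[OF s, of n] by auto
  then show ?thesis by (simp add: powr_diff)
qed simp

lemma D_nonneg: "0 \<le> lower_D s \<tau>" "lower_D s \<tau> \<le> upper_D s \<tau>"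
  unfolding lower_D_def upper_D_def
  by (auto intro!: Liminf_bounded Liminf_le_Limsup)

lemma upper_D_drop:
  assumes s: "s \<in> inc_seqs" and "\<tau> < \<tau>'" "upper_D s \<tau> \<noteq> \<infinity>"
  shows "upper_D s \<tau>' = 0"
proof -
  have "upper_D s \<tau> < \<infinity>" using assms by (simp add: less_top)
  then obtain C where C: "upper_D s \<tau> < ereal C" 
    using ereal_dense2 by blast
  have "0 \<le> upper_D s \<tau>" using D_nonneg[of s \<tau>] by order
  with C have "0 < ereal C" by order
  then have "C > 0" by simp
  have ev: "\<forall>\<^sub>F n in sequentially. real n / real (s n) powr \<tau> < C"
    using Limsup_lessD[OF C[unfolded upper_D_def]] by simp
  have "(\<lambda>n. real (s n) powr (\<tau> - \<tau>') * C) \<longlonglongrightarrow> 0"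
    using inc_seqs_quot_tendsto_0[OF s assms(2)] by (rule tendsto_mult_left_zero)
  then have "(\<lambda>n. real n / real (s n) powr \<tau>') \<longlonglongrightarrow> 0"
  proof (rule Lim_null_comparison[rotated])
    show "\<forall>\<^sub>F n in sequentially. norm (real n / real (s n) powr \<tau>') \<le> real (s n) powr (\<tau> - \<tau>') * C"
      using ev
    proof eventually_elim
      case (elim n)
      have "norm (real n / real (s n) powr \<tau>') = real n / real (s n) powr \<tau>'" by simp
      also have "\<dots> = real (s n) powr (\<tau> - \<tau>') * (real n / real (s n) powr \<tau>)"
        by (rule inc_seqs_quot_split[OF s])
      also have "\<dots> \<le> real (s n) powr (\<tau> - \<tau>') * C"
        using elim by (intro mult_left_mono) auto
      finally show ?case .
    qed
  qed
  then have "(\<lambda>n. ereal (real n / real (s n) powr \<tau>')) \<longlonglongrightarrow> 0"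
    by (simp add: zero_ereal_def)
  then show ?thesis
    unfolding upper_D_def by (intro lim_imp_Limsup) auto
qed

lemma lower_D_drop:
  assumes s: "s \<in> inc_seqs" and "\<tau> < \<tau>'" "lower_D s \<tau> \<noteq> \<infinity>"
  shows "lower_D s \<tau>' = 0"
proof (rule ccontr)
  assume "lower_D s \<tau>' \<noteq> 0"
  then have "0 < lower_D s \<tau>'" using D_nonneg(1)[of s \<tau>'] by order
  then obtain c where c: "0 < ereal c" "ereal c < lower_D s \<tau>'"
    using ereal_dense2 by blast
  then have "c > 0" by simp
  have ev: "\<forall>\<^sub>F n in sequentially. c < real n / real (s n) powr \<tau>'"
    using less_LiminfD[OF c(2)[unfolded lower_D_def]] by simp
  have "ereal K \<le> lower_D s \<tau>" for K
  proof -
    have "0 < c / (\<bar>K\<bar> + 1)" using \<open>c > 0\<close> by simp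
    from order_tendstoD(2)[OF inc_seqs_quot_tendsto_0[OF s assms(2)] this]
    have "\<forall>\<^sub>F n in sequentially. ereal K \<le> ereal (real n / real (s n) powr \<tau>)"
      using ev
    proof eventually_elim
      case (elim n)
      let ?a = "real (s n) powr (\<tau> - \<tau>')" and ?b = "real n / real (s n) powr \<tau>"
      have b: "0 \<le> ?b" by simp
      have "c < ?a * ?b" using elim(2) inc_seqs_quot_split[OF s, of n \<tau>' \<tau>] by simp
      also have "\<dots> \<le> c / (\<bar>K\<bar> + 1) * ?b"
        using elim(1) b by (intro mult_right_mono) auto
      also have "\<dots> = (c * ?b) / (\<bar>K\<bar> + 1)" by simp
      finally have "c * (\<bar>K\<bar> + 1) < c * ?b"
        by (subst (asm) pos_less_divide_eq) auto
      then have "\<bar>K\<bar> + 1 < ?b"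
        using \<open>c > 0\<close> by (metis mult_less_cancel_left_pos)
      then show ?case by simp
    qed
    then show ?thesis unfolding lower_D_def by (rule Liminf_bounded)
  qed
  then have "lower_D s \<tau> = \<infinity>"
    by (metis ereal_top)
  with assms(3) show False by simp
qed

lemma INF_eq_SUP_of_drop:
  fixes D :: "real \<Rightarrow> ereal"
  assumes drop: "\<And>\<tau> \<tau>'. \<tau> < \<tau>' \<Longrightarrow> D \<tau> \<noteq> \<infinity> \<Longrightarrow> D \<tau>' = 0" and D0: "D 0 = \<infinity>"
  shows "(INF \<tau>\<in>{\<tau>. 0 \<le> \<tau> \<and> D \<tau> = 0}. ereal \<tau>) = (SUP \<tau>\<in>{\<tau>. 0 \<le> \<tau> \<and> D \<tau> = \<infinity>}. ereal \<tau>)"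
    (is "?I = ?S")
proof (rule antisym)
  have "\<not> ?S < ?I"
  proof
    assume "?S < ?I"
    then obtain a where a: "?S < ereal a" "ereal a < ?I" using ereal_dense2 by blast
    then obtain b where b: "ereal a < ereal b" "ereal b < ?I" using ereal_dense2 by blast
    have "ereal 0 \<le> ?S" using D0 by (intro SUP_upper) auto
    with a have "ereal 0 < ereal a" by order
    then have "0 \<le> a" by simp
    have "D a \<noteq> \<infinity>"
    proof
      assume "D a = \<infinity>"
      then have "ereal a \<le> ?S" using \<open>0 \<le> a\<close> by (intro SUP_upper) auto
      with a show False by order
    qed
    then have "D b = 0" using drop b by simp
    then have "?I \<le> ereal b" using \<open>0 \<le> a\<close> b by (intro INF_lower) auto
    with b show False by order
  qed
  then show "?I \<le> ?S" by order
  show "?S \<le> ?I"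
  proof (intro SUP_least INF_greatest)
    fix x y assume "x \<in> {\<tau>. 0 \<le> \<tau> \<and> D \<tau> = \<infinity>}" "y \<in> {\<tau>. 0 \<le> \<tau> \<and> D \<tau> = 0}"
    then show "ereal x \<le> ereal y"
      using drop[of y x] by (cases x y rule: linorder_cases) auto
  qed
qed

lemma lower_D_0:
  assumes "s \<in> inc_seqs" shows "lower_D s 0 = \<infinity>"
proof -
  have "\<forall>\<^sub>F n in sequentially. ereal (real n) = ereal (real n / real (s n) powr 0)"
    using eventually_gt_at_top[of 0]
  proof eventually_elim
    case (elim n)
    then have "s n > 0" using inc_seqs_ge[OF assms, of n] by auto
    then show ?case by simp
  qed
  moreover have "(\<lambda>n. ereal (real n)) \<longlonglongrightarrow> \<infinity>"
    by (rule id_nat_ereal_tendsto_PInf)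
  ultimately have "(\<lambda>n. ereal (real n / real (s n) powr 0)) \<longlonglongrightarrow> \<infinity>"
    by (rule Lim_transform_eventually[rotated])
  then show ?thesis unfolding lower_D_def by (intro lim_imp_Liminf) auto
qed

lemma upper_dim_eq_SUP:
  assumes "s \<in> inc_seqs"
  shows "upper_dim s = (SUP \<tau>\<in>{\<tau>. 0 \<le> \<tau> \<and> upper_D s \<tau> = \<infinity>}. ereal \<tau>)"
  unfolding upper_dim_def
  using lower_D_0[OF assms] D_nonneg(2)[of s 0]
  by (intro INF_eq_SUP_of_drop upper_D_drop[OF assms]) auto

lemma lower_dim_eq_SUP:
  assumes "s \<in> inc_seqs"
  shows "lower_dim s = (SUP \<tau>\<in>{\<tau>. 0 \<le> \<tau> \<and> lower_D s \<tau> = \<infinity>}. ereal \<tau>)"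
  unfolding lower_dim_def
  using lower_D_0[OF assms]
  by (intro INF_eq_SUP_of_drop lower_D_drop[OF assms]) auto

end

theory Submission
  imports Defs
begin

text \<open>
  The two outer inequalities hold because the lower dimension of a sequence never exceeds its upper
  dimension. The equality in the middle compares two sorts of sequences, and both directions only use
  that \<open>h I\<close>, the entropy of the join of the partitions \<open>T\<^sup>-\<^sup>i \<alpha>\<close> over \<open>i \<in> I\<close>, is an increasing and
  submodular function of the finite set \<open>I\<close>, vanishes on the empty set and is bounded on singletons.
  Submodularity is the nonnegativity of conditional mutual information.

  From positive upper entropy to positive lower entropy (\<open>exists_thinning\<close>): let \<open>h\<close> be at least
  \<open>2 * a * n\<close> on the first \<open>n\<close> terms of \<open>s\<close> for infinitely many \<open>n\<close>. Go through \<open>s\<close> and keep a term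
  exactly if it adds at least \<open>a\<close> to the entropy of the terms kept so far. Every initial piece of the
  subsequence \<open>t\<close> of kept terms then has entropy at least \<open>a\<close> times its length, so \<open>t\<close> is entropy
  generating. The discarded terms among the first \<open>n\<close> account for at most \<open>a * n\<close> of the entropy, by
  submodularity; so for the infinitely many \<open>n\<close> above the kept ones carry at least \<open>a * n\<close> and hence
  form a fixed proportion of the first \<open>n\<close> terms. Therefore the upper dimension of \<open>t\<close> is at least the
  lower dimension of \<open>s\<close>.

  From positive lower entropy to positive upper entropy (\<open>exists_padding\<close>): let \<open>s\<close> be entropy
  generating and \<open>0 < \<tau> < upper_dim s\<close>. Add the integers \<open>\<lfloor>m powr (1 / \<tau>)\<rfloor>\<close> to \<open>s\<close>. This makes the
  lower dimension at least \<open>\<tau>\<close>. The added set has about \<open>N powr \<tau>\<close> elements up to \<open>N\<close>, so for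
  the infinitely many \<open>n\<close> with \<open>s\<^sub>n powr \<tau> < n\<close> the number of terms up to \<open>s\<^sub>n\<close> grows at most by
  a constant factor, and the entropy per term stays bounded away from \<open>0\<close> there. As \<open>\<tau>\<close> was arbitrary,
  the supremum of the lower dimensions over positive entropy sequences is at least \<open>upper_dim s\<close>.
\<close>

section \<open>Submodularity of Shannon entropy\<close>

context information_space
begin

text \<open>Written as an expectation, the entropies of several random variables can be evaluated on one
  joint distribution, without summing out marginals.\<close>
lemma entropy_eq_expectation:
  assumes X: "simple_function M X"
  shows "\<H>(X) = - (\<integral>\<omega>. log b (prob (X -` {X \<omega>} \<inter> space M)) \<partial>M)"
proof -
  let ?p = "\<lambda>x. prob (X -` {x} \<inter> space M)"
  have sd: "simple_distributed M X ?p"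
    by (rule simple_distributedI[OF X measure_nonneg refl])
  have "(\<integral>\<omega>. log b (?p (X \<omega>)) \<partial>M) = (\<integral>x. ?p x * log b (?p x) \<partial>count_space (X ` space M))"
    by (rule distributed_integral[OF simple_distributed[OF sd], symmetric]) auto
  also have "\<dots> = (\<Sum>x\<in>X ` space M. ?p x * log b (?p x))"
    using simple_functionD(1)[OF X] by (rule lebesgue_integral_count_space_finite)
  finally show ?thesis
    by (simp add: entropy_simple_distributed[OF sd])
qed

text \<open>The difference of the two sides is the conditional mutual information of \<open>X\<close> and \<open>Y\<close> given \<open>Z\<close>.
  Its defining sum runs over the values of \<open>(X, Y, Z)\<close>, so the four entropies are first expressed as
  sums over these values.\<close>
lemma entropy_submodular:
  assumes X: "simple_function M X" and Y: "simple_function M Y" and Z: "simple_function M Z"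
  shows "\<H>(\<lambda>\<omega>. (X \<omega>, Y \<omega>, Z \<omega>)) + \<H>(Z) \<le> \<H>(\<lambda>\<omega>. (X \<omega>, Z \<omega>)) + \<H>(\<lambda>\<omega>. (Y \<omega>, Z \<omega>))"
proof -
  note sp = simple_function_Pair
  have XZ: "simple_function M (\<lambda>\<omega>. (X \<omega>, Z \<omega>))"
    and YZ: "simple_function M (\<lambda>\<omega>. (Y \<omega>, Z \<omega>))"
    and XYZ: "simple_function M (\<lambda>\<omega>. (X \<omega>, Y \<omega>, Z \<omega>))"
    by (intro sp X Y Z)+
  let ?W = "\<lambda>\<omega>. (X \<omega>, Y \<omega>, Z \<omega>)"
  define p where "p w = prob (?W -` {w} \<inter> space M)" for w
  define pxz where "pxz w = prob ((\<lambda>\<omega>. (X \<omega>, Z \<omega>)) -` {w} \<inter> space M)" for w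
  define pyz where "pyz w = prob ((\<lambda>\<omega>. (Y \<omega>, Z \<omega>)) -` {w} \<inter> space M)" for w
  define pz where "pz w = prob (Z -` {w} \<inter> space M)" for w
  note sd = simple_distributedI[OF _ measure_nonneg refl]
  have sdW: "simple_distributed M ?W p" unfolding p_def by (rule sd[OF XYZ])
  have expW: "(\<integral>\<omega>. g (?W \<omega>) \<partial>M) = (\<Sum>w\<in>?W ` space M. p w * g w)" for g :: "_ \<Rightarrow> real"
  proof -
    have "(\<integral>\<omega>. g (?W \<omega>) \<partial>M) = (\<integral>x. p x * g x \<partial>count_space (?W ` space M))"
      by (rule distributed_integral[OF simple_distributed[OF sdW], symmetric]) (auto simp: p_def)
    also have "\<dots> = (\<Sum>w\<in>?W ` space M. p w * g w)"
      using simple_functionD(1)[OF XYZ] by (rule lebesgue_integral_count_space_finite)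
    finally show ?thesis .
  qed
  have HW: "\<H>(?W) = - (\<Sum>w\<in>?W ` space M. p w * log b (p w))"
    by (rule entropy_simple_distributed[OF sdW])
  have HZ: "\<H>(Z) = - (\<Sum>w\<in>?W ` space M. p w * log b (pz (snd (snd w))))"
    using entropy_eq_expectation[OF Z] expW[of "\<lambda>w. log b (pz (snd (snd w)))"]
    by (simp add: pz_def)
  have HXZ: "\<H>(\<lambda>\<omega>. (X \<omega>, Z \<omega>)) = - (\<Sum>w\<in>?W ` space M. p w * log b (pxz (fst w, snd (snd w))))"
    using entropy_eq_expectation[OF XZ] expW[of "\<lambda>w. log b (pxz (fst w, snd (snd w)))"]
    by (simp add: pxz_def)
  have HYZ: "\<H>(\<lambda>\<omega>. (Y \<omega>, Z \<omega>)) = - (\<Sum>w\<in>?W ` space M. p w * log b (pyz (snd w)))"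
    using entropy_eq_expectation[OF YZ] expW[of "\<lambda>w. log b (pyz (snd w))"]
    by (simp add: pyz_def)
  have cmi_term: "(case w of (x, y, z) \<Rightarrow> p (x, y, z) * log b (p (x, y, z) / (pxz (x, z) * (pyz (y, z) / pz z)))) =
      p w * log b (p w) + p w * log b (pz (snd (snd w)))
      - p w * log b (pxz (fst w, snd (snd w))) - p w * log b (pyz (snd w))" for w
  proof (cases "p w = 0")
    case True then show ?thesis by (auto split: prod.splits)
  next
    case False
    obtain x y z where w: "w = (x, y, z)" by (cases w) auto
    have pos: "0 < p w" using False by (simp add: p_def less_le measure_nonneg)
    have "p w \<le> pxz (x, z)" unfolding p_def pxz_def w
      by (intro finite_measure_mono simple_functionD(2)[OF XZ]) auto
    moreover have "p w \<le> pyz (y, z)" unfolding p_def pyz_def w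
      by (intro finite_measure_mono simple_functionD(2)[OF YZ]) auto
    moreover have "p w \<le> pz z" unfolding p_def pz_def w
      by (intro finite_measure_mono simple_functionD(2)[OF Z]) auto
    ultimately have "0 < pxz (x, z)" "0 < pyz (y, z)" "0 < pz z" using pos by linarith+
    then show ?thesis using pos
      by (simp add: w log_divide log_mult algebra_simps)
  qed
  have "0 \<le> \<I>(X ; Y | Z)"
    by (rule conditional_mutual_information_nonneg[OF X Y Z])
  also have "\<I>(X ; Y | Z) =
      (\<Sum>(x, y, z)\<in>?W ` space M. p (x, y, z) * log b (p (x, y, z) / (pxz (x, z) * (pyz (y, z) / pz z))))"
    unfolding p_def pxz_def pyz_def pz_def
    by (rule conditional_mutual_information_eq) (intro sd Z XZ YZ XYZ)+
  also have "\<dots> = \<H>(\<lambda>\<omega>. (X \<omega>, Z \<omega>)) + \<H>(\<lambda>\<omega>. (Y \<omega>, Z \<omega>)) - \<H>(?W) - \<H>(Z)"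
    unfolding cmi_term HW HXZ HYZ HZ by (simp add: sum.distrib sum_subtractf)
  finally show ?thesis by simp
qed

end

section \<open>Itineraries and the entropy of joins\<close>

text \<open>The cells visited at the times in \<open>I\<close>. A set of pairs, rather than a function of time, makes
  joining and restricting itineraries plain set operations.\<close>
definition itinerary :: "('a \<Rightarrow> 'a) \<Rightarrow> 'a set set \<Rightarrow> nat set \<Rightarrow> 'a \<Rightarrow> (nat \<times> 'a set) set"
  where "itinerary T \<alpha> I x = {(i, A). i \<in> I \<and> A \<in> \<alpha> \<and> (T ^^ i) x \<in> A}"

text \<open>The base \<open>exp 1\<close> matches the natural logarithm in \<^const>\<open>partition_entropy\<close>.\<close>
definition itinerary_entropy :: "'a measure \<Rightarrow> ('a \<Rightarrow> 'a) \<Rightarrow> 'a set set \<Rightarrow> nat set \<Rightarrow> real"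
  where "itinerary_entropy M T \<alpha> I =
    prob_space.entropy M (exp 1) (count_space (itinerary T \<alpha> I ` space M)) (itinerary T \<alpha> I)"

locale mds_partition = mds M T for M :: "'a measure" and T +
  fixes \<alpha> :: "'a set set"
  assumes partition: "\<alpha> \<in> fin_meas_partitions M"
begin

sublocale information_space M "exp 1"
  by unfold_locales simp

notation entropy_Pow ("\<H>'(_')")

abbreviation "name \<equiv> itinerary T \<alpha>"
abbreviation "h \<equiv> itinerary_entropy M T \<alpha>"

lemma h_eq: "h I = \<H>(name I)"
  by (simp add: itinerary_entropy_def)

lemma T_funpow_measurable [measurable]: "T ^^ i \<in> M \<rightarrow>\<^sub>M M"
  by (intro measurable_compose_n T_measurable)

lemma finite_cells: "finite \<alpha>" and cells_measurable: "A \<in> \<alpha> \<Longrightarrow> A \<in> sets M"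
  and cells_partition: "partition_on (space M) \<alpha>"
  using partition by (auto simp: fin_meas_partitions_def)

lemma simple_function_itinerary:
  assumes "finite I"
  shows "simple_function M (name I)"
  unfolding simple_function_def
proof (intro conjI ballI)
  have "name I ` space M \<subseteq> Pow (I \<times> \<alpha>)" by (auto simp: itinerary_def)
  then show "finite (name I ` space M)"
    using assms finite_cells by (meson finite_Pow_iff finite_SigmaI finite_subset)
  fix v assume v: "v \<in> name I ` space M"
  have "name I -` {v} \<inter> space M =
      {x \<in> space M. \<forall>i\<in>I. \<forall>A\<in>\<alpha>. (T ^^ i) x \<in> A \<longleftrightarrow> (i, A) \<in> v}"
    using v by (auto simp: itinerary_def set_eq_iff)
  also have "\<dots> \<in> sets M"
    using assms finite_cells cells_measurable by measurable
  finally show "name I -` {v} \<inter> space M \<in> sets M" .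
qed

lemma itinerary_restrict:
  assumes "I \<subseteq> J" shows "name I = (\<lambda>v. {(i, A) \<in> v. i \<in> I}) \<circ> name J"
  using assms by (auto simp: itinerary_def fun_eq_iff)

lemma h_mono:
  assumes "finite J" "I \<subseteq> J" shows "h I \<le> h J"
  unfolding h_eq itinerary_restrict[OF assms(2)]
  by (rule entropy_data_processing[OF simple_function_itinerary[OF assms(1)]])

lemma h_submodular:
  assumes "finite I" "finite J" "finite K"
  shows "h (I \<union> J \<union> K) + h K \<le> h (I \<union> K) + h (J \<union> K)"
proof -
  note sf = simple_function_itinerary
  have pair: "\<H>(\<lambda>x. (name I x, name J x)) = \<H>(name (I \<union> J))" if "finite I" "finite J" for I J
  proof (rule antisym)
    have eq: "(\<lambda>x. (name I x, name J x)) =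
        (\<lambda>v. ({(i, A) \<in> v. i \<in> I}, {(i, A) \<in> v. i \<in> J})) \<circ> name (I \<union> J)"
      by (auto simp: itinerary_def fun_eq_iff)
    show "\<H>(\<lambda>x. (name I x, name J x)) \<le> \<H>(name (I \<union> J))"
      unfolding eq by (rule entropy_data_processing[OF sf]) (use that in simp)
    have eq': "name (I \<union> J) = (\<lambda>(u, v). u \<union> v) \<circ> (\<lambda>x. (name I x, name J x))"
      by (auto simp: itinerary_def fun_eq_iff)
    show "\<H>(name (I \<union> J)) \<le> \<H>(\<lambda>x. (name I x, name J x))"
      unfolding eq' by (intro entropy_data_processing simple_function_Pair sf that)
  qed
  have "\<H>(name (I \<union> J \<union> K)) \<le> \<H>(\<lambda>x. (name I x, name J x, name K x))"
  proof -
    have eq: "name (I \<union> J \<union> K) = (\<lambda>(u, v, w). u \<union> v \<union> w) \<circ> (\<lambda>x. (name I x, name J x, name K x))"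
      by (auto simp: itinerary_def fun_eq_iff)
    show ?thesis
      unfolding eq by (intro entropy_data_processing simple_function_Pair sf assms)
  qed
  with entropy_submodular[OF sf sf sf, OF assms] pair assms show ?thesis
    by (simp add: h_eq)
qed

lemma h_empty: "h {} = 0"
proof -
  have *: "name {} = (\<lambda>_. {})" by (auto simp: itinerary_def)
  show ?thesis unfolding h_eq *
    using entropy_eq_expectation[OF simple_function_const, of "{} :: (nat \<times> 'a set) set"]
    by (simp add: prob_space vimage_def)
qed

lemma h_eq_sum:
  assumes "finite I"
  shows "h I = - (\<Sum>v\<in>name I ` space M. prob (name I -` {v} \<inter> space M) * ln (prob (name I -` {v} \<inter> space M)))"
  using entropy_simple_distributed[OF simple_distributedI[OF simple_function_itinerary[OF assms] measure_nonneg refl]]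
  by (simp add: h_eq log_def)

text \<open>Each summand \<open>- p * ln p\<close> is at most \<open>1\<close>, and there are at most as many itineraries at one time
  as sets of cells. This is far from the optimal bound \<open>ln (card \<alpha>)\<close>, but it is the same for
  all \<open>i\<close>, which is what the counting arguments need.\<close>
lemma h_singleton_le: "h {i} \<le> 2 ^ card \<alpha>"
proof -
  have "- (p * ln p) \<le> 1" if "0 \<le> p" for p :: real
  proof (cases "p = 0")
    case False
    with that have "p > 0" by simp
    with ln_le_minus_one[of "1 / p"] have "- ln p \<le> 1 / p - 1" by (simp add: ln_div)
    with \<open>p > 0\<close> have "p * (- ln p) \<le> p * (1 / p - 1)" by (intro mult_left_mono) auto
    with \<open>p > 0\<close> show ?thesis by (simp add: algebra_simps)
  qed simp
  then have "h {i} \<le> (\<Sum>v\<in>name {i} ` space M. 1)"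
    unfolding h_eq_sum[OF finite.insertI[OF finite.emptyI]] sum_negf[symmetric]
    by (intro sum_mono) auto
  also have "\<dots> \<le> 2 ^ card \<alpha>"
  proof -
    have "name {i} ` space M \<subseteq> Pow ({i} \<times> \<alpha>)" by (auto simp: itinerary_def)
    then have "card (name {i} ` space M) \<le> card (Pow ({i} \<times> \<alpha>))"
      using finite_cells by (intro card_mono) auto
    also have "\<dots> = 2 ^ card \<alpha>"
      using finite_cells by (simp add: card_Pow card_cartesian_product_singleton)
    finally have "real (card (name {i} ` space M)) \<le> real (2 ^ card \<alpha>)" by (rule of_nat_mono)
    then show ?thesis by simp
  qed
  finally show ?thesis .
qed

lemma partition_on_pullback: "partition_on (space M) (pullback M (T ^^ i) \<alpha>)"
proof (rule partition_onI)
  show "\<Union> (pullback M (T ^^ i) \<alpha>) = space M"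
  proof (intro equalityI subsetI)
    fix x assume x: "x \<in> space M"
    then have "(T ^^ i) x \<in> \<Union>\<alpha>"
      using measurable_space[OF T_funpow_measurable] partition_onD1[OF cells_partition] by simp
    then obtain A where "A \<in> \<alpha>" "(T ^^ i) x \<in> A" by auto
    then have "(T ^^ i) -` A \<inter> space M \<in> pullback M (T ^^ i) \<alpha>" "x \<in> (T ^^ i) -` A \<inter> space M"
      using x by (auto simp: pullback_def)
    then show "x \<in> \<Union> (pullback M (T ^^ i) \<alpha>)" by (rule UnionI)
  qed (auto simp: pullback_def)
  fix P Q assume PQ: "P \<in> pullback M (T ^^ i) \<alpha>" "Q \<in> pullback M (T ^^ i) \<alpha>" "P \<noteq> Q"
  then obtain A B where AB: "A \<in> \<alpha>" "P = (T ^^ i) -` A \<inter> space M" "B \<in> \<alpha>" "Q = (T ^^ i) -` B \<inter> space M"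
    unfolding pullback_def by auto
  with PQ have "A \<inter> B = {}"
    using disjointD[OF partition_onD2[OF cells_partition] AB(1,3)] by blast
  with AB show "disjnt P Q" by (auto simp: disjnt_def)
qed (auto simp: pullback_def)

text \<open>The index set must be nonempty: the common refinement of no partitions at all is \<open>{UNIV}\<close>, which
  need not be a partition of the space.\<close>
lemma join_eq_itinerary_fibres:
  assumes "I \<noteq> {}"
  shows "common_refinement ((\<lambda>i. pullback M (T ^^ i) \<alpha>) ` I) =
    (\<lambda>v. name I -` {v} \<inter> space M) ` name I ` space M" (is "?J = ?K")
proof -
  let ?P = "(\<lambda>i. pullback M (T ^^ i) \<alpha>) ` I"
  have part: "partition_on (space M) ?J"
    using assms partition_on_pullback by (intro partition_on_common_refinement) auto
  \<comment> \<open>A cell of the join prescribes one cell \<open>A i\<close> of \<open>\<alpha>\<close> for every time \<open>i\<close>, that is, an itinerary.\<close>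
  have cell: "B = name I -` {name I x} \<inter> space M" if "B \<in> ?J" "x \<in> B" for B x
  proof -
    have "\<exists>f\<in>(\<Pi> P\<in>?P. P). B = \<Inter> (f ` ?P)"
      using that(1) unfolding common_refinement by simp
    then obtain f where f_Pi: "f \<in> (\<Pi> P\<in>?P. P)" and B: "B = \<Inter> (f ` ?P)"
      by (rule bexE) (rule that)
    have f: "f P \<in> P" if "P \<in> ?P" for P using f_Pi that by (rule Pi_mem)
    have "\<exists>A\<in>\<alpha>. f (pullback M (T ^^ i) \<alpha>) = (T ^^ i) -` A \<inter> space M" if "i \<in> I" for i
      using f[of "pullback M (T ^^ i) \<alpha>"] that by (auto simp: pullback_def)
    then obtain A where A: "\<And>i. i \<in> I \<Longrightarrow> A i \<in> \<alpha>"
      "\<And>i. i \<in> I \<Longrightarrow> f (pullback M (T ^^ i) \<alpha>) = (T ^^ i) -` A i \<inter> space M"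
      by metis
    have B': "B = {y \<in> space M. \<forall>i\<in>I. (T ^^ i) y \<in> A i}"
      using assms by (auto simp: B A(2))
    have uniq: "A' = A i" if "i \<in> I" "A' \<in> \<alpha>" "(T ^^ i) y \<in> A'" "(T ^^ i) y \<in> A i" for i A' y
      using that A(1)[OF that(1)] partition_onD2[OF cells_partition] by (auto simp: disjoint_def)
    have name: "name I y = {(i, A i) | i. i \<in> I}" if "y \<in> B" for y
      using that A(1) uniq by (auto simp: B' itinerary_def)
    show ?thesis
    proof (intro equalityI subsetI)
      fix y assume "y \<in> B"
      then show "y \<in> name I -` {name I x} \<inter> space M"
        using name[OF \<open>y \<in> B\<close>] name[OF \<open>x \<in> B\<close>] by (auto simp: B')
    next
      fix y assume "y \<in> name I -` {name I x} \<inter> space M"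
      then have "y \<in> space M" and "name I y = {(i, A i) | i. i \<in> I}" using name[OF \<open>x \<in> B\<close>] by auto
      then show "y \<in> B" by (auto simp: B' itinerary_def set_eq_iff)
    qed
  qed
  show ?thesis
  proof (intro equalityI subsetI)
    fix B assume B: "B \<in> ?J"
    then have "B \<noteq> {}" "B \<subseteq> space M" using partition_onD3[OF part] partition_onD1[OF part] by auto
    then obtain x where "x \<in> B" "x \<in> space M" by auto
    with cell[OF B] show "B \<in> ?K" by blast
  next
    fix B assume "B \<in> ?K"
    then obtain x where x: "x \<in> space M" "B = name I -` {name I x} \<inter> space M" by auto
    then obtain B' where "B' \<in> ?J" "x \<in> B'" using partition_onD1[OF part] by auto
    with cell x show "B \<in> ?J" by metis
  qed
qed

text \<open>Dividing by \<open>n\<close> makes the equation hold at \<open>n = 0\<close> as well, where both sides are \<open>0\<close> since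
  division by \<open>0\<close> yields \<open>0\<close>.\<close>
lemma partition_entropy_join:
  "1 / real n * partition_entropy M (join_along M T \<alpha> s n) = h (s ` {1..n}) / real n"
proof (cases "n = 0")
  case False
  let ?I = "s ` {1..n}"
  let ?f = "\<lambda>v. name ?I -` {v} \<inter> space M"
  have "join_along M T \<alpha> s n = common_refinement ((\<lambda>i. pullback M (T ^^ i) \<alpha>) ` ?I)"
    by (simp add: join_along_def image_image)
  also have "\<dots> = ?f ` name ?I ` space M"
    using False by (intro join_eq_itinerary_fibres) auto
  finally have "partition_entropy M (join_along M T \<alpha> s n) =
      - (\<Sum>A\<in>?f ` name ?I ` space M. prob A * ln (prob A))"
    by (simp add: partition_entropy_def)
  also have "inj_on ?f (name ?I ` space M)"
    by (auto simp: inj_on_def)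
  then have "(\<Sum>A\<in>?f ` name ?I ` space M. prob A * ln (prob A)) =
      (\<Sum>v\<in>name ?I ` space M. prob (?f v) * ln (prob (?f v)))"
    by (simp add: sum.reindex)
  also have "- \<dots> = h ?I" by (simp add: h_eq_sum)
  finally show ?thesis by simp
qed simp

end

section \<open>Enumerating sets of positive integers\<close>

text \<open>\<^const>\<open>enumerate\<close> counts from \<open>0\<close>, members of \<^const>\<open>inc_seqs\<close> count from \<open>1\<close>; the shift
  mediates between the two.\<close>
definition seq_of :: "nat set \<Rightarrow> nat \<Rightarrow> nat"
  where "seq_of A n = enumerate A (n - 1)"

lemma seq_of_in_inc_seqs:
  assumes "infinite A" "A \<subseteq> {1..}" shows "seq_of A \<in> inc_seqs"
  using assms enumerate_in_set[OF assms(1)]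
  by (fastforce simp: inc_seqs_def seq_of_def intro!: strict_mono_onI enumerate_mono)

text \<open>This turns counting in a set into information on its enumeration: the elements up to \<open>N\<close> are
  an initial piece of the enumeration, whose length is their number.\<close>
lemma seq_of_initial:
  assumes A: "infinite A"
  shows "seq_of A ` {1..card (A \<inter> {..N})} = A \<inter> {..N}"
proof -
  define k where "k = (LEAST j. N < enumerate A j)"
  have "N < enumerate A (Suc N)" using le_enumerate[OF A, of "Suc N"] by simp
  then have k: "N < enumerate A k" unfolding k_def by (rule LeastI)
  have lt: "enumerate A j \<le> N \<longleftrightarrow> j < k" for j
  proof
    assume "enumerate A j \<le> N"
    with k have "enumerate A j < enumerate A k" by simp
    with A show "j < k" by simp
  next
    assume "j < k" then show "enumerate A j \<le> N"
      unfolding k_def using not_less_Least by (meson not_le)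
  qed
  have img: "enumerate A ` {..<k} = A \<inter> {..N}"
    using lt enumerate_in_set[OF A] enumerate_Ex[OF A] by fastforce
  have "card (enumerate A ` {..<k}) = k"
    by (subst card_image) (auto intro: inj_on_subset[OF inj_enumerate[OF A]])
  with img have card: "card (A \<inter> {..N}) = k" by simp
  have "seq_of A ` {1..k} = enumerate A ` ((\<lambda>n. n - 1) ` {1..k})"
    by (simp add: seq_of_def image_image)
  also have "(\<lambda>n. n - 1) ` {1..k} = {..<k}"
  proof -
    have "j \<in> (\<lambda>n. n - 1) ` {1..k}" if "j < k" for j
      using that by (intro image_eqI[of _ _ "Suc j"]) auto
    then show ?thesis by auto
  qed
  finally show ?thesis using img card by simp
qed

text \<open>Large counting functions give small enumerations; every lower bound on a dimension comes from
  this.\<close>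
lemma seq_of_le:
  assumes A: "infinite A" "1 \<le> m" "m \<le> card (A \<inter> {..N})"
  shows "seq_of A m \<le> N"
  using seq_of_initial[OF A(1), of N] assms(2,3) by auto

lemma seq_of_image:
  assumes A: "infinite A" "A \<subseteq> {1..}" and n: "1 \<le> n"
  shows "seq_of A ` {1..n} = A \<inter> {..seq_of A n}"
proof -
  have inc: "strict_mono_on {1..} (seq_of A)" using seq_of_in_inc_seqs[OF A(1,2)] by (simp add: inc_seqs_def)
  show ?thesis
  proof (intro equalityI subsetI)
    fix x assume "x \<in> seq_of A ` {1..n}"
    then show "x \<in> A \<inter> {..seq_of A n}"
      using strict_mono_on_leD[OF inc] enumerate_in_set[OF A(1)] by (auto simp: seq_of_def)
  next
    fix x assume x: "x \<in> A \<inter> {..seq_of A n}"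
    then obtain j where "enumerate A j = x" using enumerate_Ex[OF A(1)] by auto
    with x have "enumerate A j \<le> enumerate A (n - 1)" by (simp add: seq_of_def)
    then have "j \<le> n - 1" using enumerate_mono_le_iff[OF A(1)] by blast
    with \<open>enumerate A j = x\<close> n show "x \<in> seq_of A ` {1..n}"
      by (intro image_eqI[of _ _ "Suc j"]) (auto simp: seq_of_def)
  qed
qed

lemma dims_nonneg: "0 \<le> lower_dim s" "0 \<le> upper_dim s"
  by (auto simp: lower_dim_def upper_dim_def intro!: INF_greatest)

lemma lower_dim_le_upper_dim: "lower_dim s \<le> upper_dim s"
  unfolding lower_dim_def upper_dim_def
proof (rule INF_superset_mono)
  show "{\<tau>. 0 \<le> \<tau> \<and> upper_D s \<tau> = 0} \<subseteq> {\<tau>. 0 \<le> \<tau> \<and> lower_D s \<tau> = 0}"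
    using D_nonneg[of s] by (auto intro: antisym) (metis antisym)
qed simp

section \<open>Thinning a sequence of positive upper entropy\<close>

text \<open>In the application \<open>h I\<close> is the entropy of the join of the partitions \<open>T\<^sup>-\<^sup>i \<alpha>\<close> over
  \<open>i \<in> I\<close>.\<close>
locale submodular_set_function =
  fixes h :: "nat set \<Rightarrow> real" and C :: real
  assumes increasing: "\<And>I J. finite J \<Longrightarrow> I \<subseteq> J \<Longrightarrow> h I \<le> h J"
    and submodular: "\<And>I J K. finite I \<Longrightarrow> finite J \<Longrightarrow> finite K \<Longrightarrow>
      h (I \<union> J \<union> K) + h K \<le> h (I \<union> K) + h (J \<union> K)"
    and empty_eq_0: "h {} = 0"
    and singleton_le: "\<And>i. h {i} \<le> C"
begin

lemma nonneg: "finite I \<Longrightarrow> 0 \<le> h I"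
  using increasing[of I "{}"] empty_eq_0 by simp

lemma increment_antimono:
  assumes "finite J" "I \<subseteq> J"
  shows "h (insert i J) - h J \<le> h (insert i I) - h I"
proof -
  have "{i} \<union> J \<union> I = insert i J" "{i} \<union> I = insert i I" "J \<union> I = J" using assms by auto
  with submodular[of "{i}" J I] assms show ?thesis by (auto dest: finite_subset)
qed

lemma le_card:
  assumes "finite I" shows "h I \<le> C * card I"
  using assms
proof induction
  case (insert i I)
  have "h (insert i I) \<le> h I + h {i}"
    using increment_antimono[of I "{}" i] insert by (simp add: empty_eq_0)
  also have "\<dots> \<le> C * card I + C" using insert singleton_le[of i] by simp
  finally show ?case using insert by (simp add: algebra_simps)
qed (simp add: empty_eq_0)

text \<open>Run through the indices and keep \<open>i\<close> exactly if \<open>s i\<close> adds at least \<open>a\<close> to the value on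
  what has been kept before. Then every kept index contributes at least \<open>a\<close>, which gives the first
  inequality. A discarded index adds at most \<open>a\<close> to the value on the kept part, hence by
  submodularity at most \<open>a\<close> to the value on the larger set of everything seen so far; this gives the
  second one. The selection is made once and works for all \<open>n\<close> simultaneously.\<close>
lemma greedy_selection:
  fixes s :: "nat \<Rightarrow> nat" and a :: real
  assumes "0 \<le> a"
  obtains J where "J \<subseteq> {1..}"
    "\<And>n. a * card (J \<inter> {..n}) \<le> h (s ` (J \<inter> {..n}))"
    "\<And>n. h (s ` {1..n}) \<le> h (s ` (J \<inter> {..n})) + a * real n"
proof -
  define G where "G = rec_nat {} (\<lambda>n I. if a \<le> h (s ` insert (Suc n) I) - h (s ` I) then insert (Suc n) I else I)"
  have G0: "G 0 = {}" and
    GS: "\<And>n. G (Suc n) = (if a \<le> h (s ` insert (Suc n) (G n)) - h (s ` G n) then insert (Suc n) (G n) else G n)"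
    by (simp_all add: G_def)
  have G_sub: "G n \<subseteq> {1..n}" for n
    by (induction n) (auto simp: G0 GS)
  have fin: "finite (G n)" for n using G_sub by (rule finite_subset) simp
  define J where "J = (\<Union>n. G n)"
  have step: "G (Suc n) \<inter> {..n} = G n" for n using G_sub[of n] by (auto simp: GS split: if_splits)
  have G_stable: "G m \<inter> {..n} = G n" if "n \<le> m" for n m
    using that
  proof (induction m rule: dec_induct)
    case base then show ?case using G_sub[of n] by auto
  next
    case (step m) then show ?case by (auto simp: GS split: if_splits)
  qed
  have JG: "J \<inter> {..n} = G n" for n
  proof (intro equalityI subsetI)
    fix x assume "x \<in> J \<inter> {..n}"
    then obtain m where "x \<in> G m" "x \<le> n" by (auto simp: J_def)
    then show "x \<in> G n"
      using G_stable[of n m] G_stable[of m n] by (cases "n \<le> m") auto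
  next
    fix x assume "x \<in> G n" then show "x \<in> J \<inter> {..n}" using G_sub[of n] by (auto simp: J_def)
  qed
  show ?thesis
  proof (rule that[of J])
    show "J \<subseteq> {1..}" using G_sub by (auto simp: J_def) (metis Suc_le_eq atLeastAtMost_iff in_mono)
    fix n
    have "a * card (G n) \<le> h (s ` G n)"
    proof (induction n)
      case (Suc n)
      have "Suc n \<notin> G n" using G_sub[of n] by auto
      then show ?case using Suc fin[of n] by (auto simp: GS algebra_simps)
    qed (simp add: G0 empty_eq_0)
    then show "a * card (J \<inter> {..n}) \<le> h (s ` (J \<inter> {..n}))" by (simp add: JG)
    have *: "h (s ` {1..n}) \<le> h (s ` G n) + a * card ({1..n} - G n)"
    proof (induction n)
      case (Suc n)
      have ins: "s ` {1..Suc n} = insert (s (Suc n)) (s ` {1..n})" by (auto simp: atLeastAtMostSuc_conv)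
      \<comment> \<open>\<open>h\<close> of all elements minus \<open>h\<close> of the kept ones does not grow when both sets gain an element.\<close>
      have inc: "h (insert (s (Suc n)) (s ` {1..n})) - h (s ` {1..n}) \<le>
          h (insert (s (Suc n)) (s ` G n)) - h (s ` G n)"
        using G_sub[of n] by (intro increment_antimono) auto
      show ?case
      proof (cases "a \<le> h (s ` insert (Suc n) (G n)) - h (s ` G n)")
        case True
        then have "{1..Suc n} - G (Suc n) = {1..n} - G n"
          by (auto simp: GS)
        with True inc Suc ins show ?thesis by (simp add: GS)
      next
        case False
        then have "{1..Suc n} - G (Suc n) = insert (Suc n) ({1..n} - G n)"
          using G_sub[of n] by (auto simp: GS)
        then have "card ({1..Suc n} - G (Suc n)) = Suc (card ({1..n} - G n))" by simp
        with False inc Suc ins show ?thesis by (simp add: GS algebra_simps)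
      qed
    qed (simp add: G0)
    show "h (s ` {1..n}) \<le> h (s ` (J \<inter> {..n})) + a * real n"
    proof -
      have "card ({1..n} - G n) \<le> n" using card_mono[of "{1..n}" "{1..n} - G n"] by simp
      with \<open>0 \<le> a\<close> have "a * card ({1..n} - G n) \<le> a * n" by (intro mult_left_mono) auto
      with * show ?thesis by (simp add: JG)
    qed
  qed
qed

text \<open>Take the greedy selection whose threshold \<open>a\<close> is half of a number below the limit superior. If
  \<open>h (s ` {1..n}) > 2 * a * n\<close>, then the kept part of \<open>{1..n}\<close> has value at least \<open>a * n\<close>, hence at
  least \<open>a * n / D\<close> elements because each contributes at most a constant \<open>D\<close>. So along infinitely many
  \<open>n\<close> a fixed proportion of \<open>s\<close> is kept, and at those \<open>n\<close> the quotients \<open>n / s\<^sub>n powr \<tau>\<close>, all of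
  which are large when \<open>lower_D s \<tau> = \<infinity>\<close>, are reproduced by the selected sequence up to a
  constant factor. Infinitely many \<open>n\<close> are enough for an upper dimension only.\<close>
lemma exists_thinning:
  assumes s: "s \<in> inc_seqs" and pos: "0 < limsup (\<lambda>n. ereal (h (s ` {1..n}) / real n))"
  obtains t where "t \<in> inc_seqs" "0 < liminf (\<lambda>n. ereal (h (t ` {1..n}) / real n))"
    "lower_dim s \<le> upper_dim t"
proof -
  obtain c where c: "0 < ereal c" "ereal c < limsup (\<lambda>n. ereal (h (s ` {1..n}) / real n))"
    using ereal_dense2[OF pos] by blast
  define a where "a = c / 2"
  have a: "0 < a" "c = 2 * a" using c by (auto simp: a_def)
  \<comment> \<open>\<open>C\<close> may be \<open>0\<close>, but a positive bound is needed to divide by it.\<close>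
  define D where "D = C + 1"
  have D: "0 < D" using nonneg[of "{0}"] singleton_le[of 0] by (simp add: D_def)
  obtain J where J: "J \<subseteq> {1..}" "\<And>n. a * card (J \<inter> {..n}) \<le> h (s ` (J \<inter> {..n}))"
    "\<And>n. h (s ` {1..n}) \<le> h (s ` (J \<inter> {..n})) + a * real n"
    using greedy_selection[of a s] a by auto
  have "\<exists>\<^sub>F n in sequentially. c < h (s ` {1..n}) / real n"
  proof (rule ccontr)
    assume "\<not> ?thesis"
    then have "\<forall>\<^sub>F n in sequentially. ereal (h (s ` {1..n}) / real n) \<le> ereal c"
      by (simp add: not_frequently not_less)
    then have "limsup (\<lambda>n. ereal (h (s ` {1..n}) / real n)) \<le> ereal c" by (rule Limsup_bounded)
    with c show False by order
  qed
  then have dense: "\<exists>\<^sub>F n in sequentially. a * real n \<le> D * card (J \<inter> {..n})"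
  proof (rule frequently_rev_mp, intro always_eventually allI impI)
    fix n assume n: "c < h (s ` {1..n}) / real n"
    then have "0 < n" using c by (cases "n = 0") auto
    with n have "2 * a * n < h (s ` {1..n})" by (simp add: a field_simps)
    with J(3)[of n] have "a * n \<le> h (s ` (J \<inter> {..n}))" by simp
    also have "\<dots> \<le> C * card (s ` (J \<inter> {..n}))" by (intro le_card) auto
    also have "\<dots> \<le> D * card (s ` (J \<inter> {..n}))" by (simp add: D_def algebra_simps)
    also have "\<dots> \<le> D * card (J \<inter> {..n})"
      using D by (intro mult_left_mono) (auto intro: card_image_le)
    finally show "a * real n \<le> D * card (J \<inter> {..n})" .
  qed
  have large: "\<forall>\<^sub>F n in sequentially. K < a * real n" for K
    using filterlim_tendsto_pos_mult_at_top[OF tendsto_const a(1) filterlim_real_sequentially]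
    by (simp add: filterlim_at_top_dense)
  have inf: "infinite J"
  proof
    assume fin: "finite J"
    obtain n where n: "a * real n \<le> D * card (J \<inter> {..n})" "D * card J < a * real n"
      using frequently_eventually_frequently[OF dense large[of "D * card J"]]
      by (auto dest: frequently_ex)
    have "D * card (J \<inter> {..n}) \<le> D * card J"
      using D fin by (intro mult_left_mono) (auto intro: card_mono)
    with n show False by simp
  qed
  define t where "t = s \<circ> seq_of J"
  have J_inc: "seq_of J \<in> inc_seqs" by (rule seq_of_in_inc_seqs[OF inf J(1)])
  have t: "t \<in> inc_seqs"
    using s J_inc by (simp add: inc_seqs_def t_def strict_mono_on_def)
  show ?thesis
  proof (rule that[OF t])
    have "\<forall>\<^sub>F k in sequentially. ereal a \<le> ereal (h (t ` {1..k}) / real k)"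
      using eventually_gt_at_top[of 0]
    proof eventually_elim
      case (elim k)
      have im: "seq_of J ` {1..k} = J \<inter> {..seq_of J k}"
        using seq_of_image[OF inf J(1)] elim by simp
      have "inj_on (seq_of J) {1..k}"
        using J_inc strict_mono_on_imp_inj_on inj_on_subset[of "seq_of J" "{1..}" "{1..k}"]
        by (auto simp: inc_seqs_def)
      then have "card (J \<inter> {..seq_of J k}) = k"
        unfolding im[symmetric] by (subst card_image) auto
      moreover have "t ` {1..k} = s ` (J \<inter> {..seq_of J k})"
        unfolding im[symmetric] t_def by (rule image_comp[symmetric])
      ultimately have "a * k \<le> h (t ` {1..k})" using J(2)[of "seq_of J k"] by simp
      with elim show ?case by (simp add: field_simps)
    qed
    then have "ereal a \<le> liminf (\<lambda>k. ereal (h (t ` {1..k}) / real k))" by (rule Liminf_bounded)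
    moreover have "0 < ereal a" using a by simp
    ultimately show "0 < liminf (\<lambda>k. ereal (h (t ` {1..k}) / real k))" by order
    show "lower_dim s \<le> upper_dim t"
      unfolding lower_dim_eq_SUP[OF s] upper_dim_eq_SUP[OF t]
    proof (rule SUP_subset_mono)
      show "{\<tau>. 0 \<le> \<tau> \<and> lower_D s \<tau> = \<infinity>} \<subseteq> {\<tau>. 0 \<le> \<tau> \<and> upper_D t \<tau> = \<infinity>}"
      proof safe
        fix \<tau> :: real assume \<tau>: "0 \<le> \<tau>" "lower_D s \<tau> = \<infinity>"
        show "upper_D t \<tau> = \<infinity>"
        proof (rule ccontr)
          assume "upper_D t \<tau> \<noteq> \<infinity>"
          then obtain L where L: "upper_D t \<tau> < ereal L"
            using ereal_dense2[of "upper_D t \<tau>" \<infinity>] by (auto simp: less_top)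
          have "\<forall>\<^sub>F k in sequentially. real k / real (t k) powr \<tau> < L"
            using Limsup_lessD[OF L[unfolded upper_D_def]] by simp
          then obtain k0 where k0: "\<And>k. k0 \<le> k \<Longrightarrow> real k / real (t k) powr \<tau> < L"
            by (auto simp: eventually_sequentially)
          have "ereal (L * D / a) < liminf (\<lambda>n. ereal (real n / real (s n) powr \<tau>))"
            using \<tau>(2) by (simp add: lower_D_def)
          from less_LiminfD[OF this]
          have "\<forall>\<^sub>F n in sequentially. L * D / a < real n / real (s n) powr \<tau>" by simp
          from eventually_conj[OF this large[of "D * (k0 + 1)"]]
          obtain n where n: "a * real n \<le> D * card (J \<inter> {..n})"
              "L * D / a < real n / real (s n) powr \<tau>" "D * (k0 + 1) < a * real n"
            using frequently_eventually_frequently[OF dense] by (auto dest: frequently_ex)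
          define k where "k = card (J \<inter> {..n})"
          have "D * (k0 + 1) < D * k" using n by (simp add: k_def)
          then have k: "k0 + 1 < k" using D by (simp add: mult_less_cancel_left_pos)
          then have le: "seq_of J k \<le> n" "1 \<le> seq_of J k"
            using seq_of_le[OF inf, of k n] J_inc by (auto simp: k_def inc_seqs_def)
          have "strict_mono_on {1..} s" using s by (simp add: inc_seqs_def)
          with le have "t k \<le> s n" by (auto simp: t_def intro: strict_mono_on_leD)
          moreover have "0 < t k" using inc_seqs_ge[OF t, of k] k by simp
          ultimately have tk: "0 < real (t k) powr \<tau>" "real (t k) powr \<tau> \<le> real (s n) powr \<tau>"
            using \<tau>(1) by (auto intro: powr_mono2)
          have "L = a / D * (L * D / a)" using a D by simp
          also have "\<dots> < a / D * (real n / real (s n) powr \<tau>)"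
            using n(2) a D by (intro mult_strict_left_mono) auto
          also have "\<dots> = (a * n / D) / real (s n) powr \<tau>" by simp
          also have "\<dots> \<le> k / real (s n) powr \<tau>"
            using n(1) D by (intro divide_right_mono) (auto simp: k_def field_simps)
          also have "\<dots> \<le> k / real (t k) powr \<tau>"
            by (intro divide_left_mono mult_pos_pos less_le_trans[OF tk] tk) simp
          finally show False using k0[of k] k by simp
        qed
      qed
    qed simp
  qed
qed

end

section \<open>Padding a sequence of positive lower entropy\<close>

text \<open>A standard sequence of dimension \<open>\<tau>\<close>: it has about \<open>N powr \<tau>\<close> elements up to \<open>N\<close>.\<close>
definition power_seq :: "real \<Rightarrow> nat \<Rightarrow> nat"
  where "power_seq \<tau> m = nat \<lfloor>real m powr (1 / \<tau>)\<rfloor>"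

lemma power_seq_powr_le:
  assumes "0 < \<tau>" shows "real (power_seq \<tau> m) powr \<tau> \<le> real m"
proof -
  have "real (power_seq \<tau> m) \<le> real m powr (1 / \<tau>)"
    by (simp add: power_seq_def)
  then have "real (power_seq \<tau> m) powr \<tau> \<le> (real m powr (1 / \<tau>)) powr \<tau>"
    using assms by (intro powr_mono2) auto
  with assms show ?thesis by (simp add: powr_powr)
qed

text \<open>For exponents \<open>1 / \<tau> \<ge> 1\<close> consecutive powers differ by at least \<open>1\<close>, so that rounding down
  keeps them apart.\<close>
lemma power_seq_step:
  assumes "0 < \<tau>" "\<tau> \<le> 1" "1 \<le> m"
  shows "power_seq \<tau> m < power_seq \<tau> (Suc m)"
proof -
  define p where "p = 1 / \<tau>"
  have p: "1 \<le> p" using assms by (simp add: p_def)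
  have "real m powr p + 1 \<le> real m powr p + real m powr (p - 1)"
    using assms p by (simp add: ge_one_powr_ge_zero)
  also have "\<dots> = real m powr (p - 1) * real (Suc m)"
    using assms by (simp add: powr_diff field_simps)
  also have "\<dots> \<le> real (Suc m) powr (p - 1) * real (Suc m)"
    using p by (intro mult_right_mono powr_mono2) auto
  also have "\<dots> = real (Suc m) powr p" by (simp add: powr_diff)
  finally have "\<lfloor>real m powr p\<rfloor> < \<lfloor>real (Suc m) powr p\<rfloor>" by linarith
  moreover have "0 \<le> \<lfloor>real m powr p\<rfloor>" by simp
  ultimately show ?thesis by (simp only: power_seq_def p_def[symmetric] nat_mono_iff)
qed

lemma power_seq_in_inc_seqs:
  assumes "0 < \<tau>" "\<tau> \<le> 1" shows "power_seq \<tau> \<in> inc_seqs"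
proof -
  have less: "power_seq \<tau> m < power_seq \<tau> n" if "1 \<le> m" "m < n" for m n
    using that(2,1)
  proof (induction rule: less_Suc_induct)
    case (1 i) then show ?case using power_seq_step assms by blast
  qed auto
  moreover have "1 \<le> power_seq \<tau> n" if "1 \<le> n" for n
  proof (cases "n = 1")
    case False
    with less[of 1 n] that show ?thesis by simp
  qed (simp add: power_seq_def)
  ultimately show ?thesis by (auto simp: inc_seqs_def intro!: strict_mono_onI)
qed

lemma card_power_seq_le:
  assumes "0 < \<tau>" "\<tau> \<le> 1" "1 \<le> N"
  shows "real (card (power_seq \<tau> ` {1..} \<inter> {..N})) \<le> 2 * real N powr \<tau>"
proof -
  define r where "r = nat \<lfloor>2 * real N powr \<tau>\<rfloor>"
  have "m \<le> r" if "power_seq \<tau> m \<le> N" for m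
  proof -
    have "real m powr (1 / \<tau>) \<le> 2 * real N"
    proof -
      have "real m powr (1 / \<tau>) < real_of_int \<lfloor>real m powr (1 / \<tau>)\<rfloor> + 1" by linarith
      also have "\<dots> \<le> real N + 1" using that by (simp add: power_seq_def nat_le_iff)
      finally show ?thesis using assms by simp
    qed
    then have "(real m powr (1 / \<tau>)) powr \<tau> \<le> (2 * real N) powr \<tau>"
      using assms by (intro powr_mono2) auto
    also have "\<dots> = 2 powr \<tau> * real N powr \<tau>" by (simp add: powr_mult)
    also have "\<dots> \<le> 2 powr 1 * real N powr \<tau>"
      using assms by (intro mult_right_mono powr_mono) auto
    finally have "real m \<le> 2 * real N powr \<tau>" using assms by (simp add: powr_powr)
    then show ?thesis by (simp add: r_def le_nat_floor)
  qed
  then have "power_seq \<tau> ` {1..} \<inter> {..N} \<subseteq> power_seq \<tau> ` {1..r}" by auto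
  then have "card (power_seq \<tau> ` {1..} \<inter> {..N}) \<le> card (power_seq \<tau> ` {1..r})"
    by (intro card_mono) auto
  also have "\<dots> \<le> r" using card_image_le[of "{1..r}" "power_seq \<tau>"] by simp
  finally have "real (card (power_seq \<tau> ` {1..} \<inter> {..N})) \<le> real r" by simp
  also have "\<dots> \<le> 2 * real N powr \<tau>" by (simp add: r_def)
  finally show ?thesis .
qed

context submodular_set_function
begin

text \<open>Add to \<open>s\<close> all elements of \<^term>\<open>power_seq \<tau>\<close>. The union \<open>A\<close> has at least as many elements up
  to every bound as \<^term>\<open>power_seq \<tau>\<close>, so its lower dimension is at least \<open>\<tau>\<close>. As
  \<open>\<tau> < upper_dim s\<close>, there are infinitely many \<open>n\<close> with \<open>s\<^sub>n powr \<tau> < n\<close>, and for these only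
  \<open>2 * n\<close> elements at most are added up to \<open>s\<^sub>n\<close>. At such \<open>n\<close> the value on an initial piece of \<open>A\<close>
  of length at most \<open>3 * n\<close> is at least \<open>h (s ` {1..n})\<close>, which is linear in \<open>n\<close>.\<close>
lemma exists_padding:
  assumes s: "s \<in> inc_seqs" and pos: "0 < liminf (\<lambda>n. ereal (h (s ` {1..n}) / real n))"
    and \<tau>: "0 < \<tau>" "ereal \<tau> < upper_dim s"
  obtains t where "t \<in> inc_seqs" "0 < limsup (\<lambda>n. ereal (h (t ` {1..n}) / real n))"
    "ereal \<tau> \<le> lower_dim t"
proof -
  obtain \<tau>' where \<tau>': "\<tau> < \<tau>'" "upper_D s \<tau>' = \<infinity>"
    using \<tau>(2) unfolding upper_dim_eq_SUP[OF s] less_SUP_iff by auto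
  have s_mono: "strict_mono_on {1..} s" using s by (simp add: inc_seqs_def)
  have dense: "\<exists>\<^sub>F n in sequentially. real (s n) powr \<tau>' < real n"
  proof (rule ccontr)
    assume "\<not> ?thesis"
    then have "\<forall>\<^sub>F n in sequentially. real n \<le> real (s n) powr \<tau>'"
      by (simp add: not_frequently not_less)
    then have "\<forall>\<^sub>F n in sequentially. ereal (real n / real (s n) powr \<tau>') \<le> 1"
      by eventually_elim (auto simp: divide_le_eq_1)
    then have "upper_D s \<tau>' \<le> 1" unfolding upper_D_def by (rule Limsup_bounded)
    with \<tau>'(2) show False by simp
  qed
  \<comment> \<open>Since \<open>n \<le> s\<^sub>n\<close>, no dimension exceeds \<open>1\<close>; this makes \<^term>\<open>power_seq \<tau>\<close> strictly increasing.\<close>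
  have "\<tau>' < 1"
  proof (rule ccontr)
    assume "\<not> \<tau>' < 1"
    obtain n where n: "real (s n) powr \<tau>' < real n" "1 \<le> n"
      using frequently_eventually_frequently[OF dense eventually_ge_at_top[of 1]]
      by (auto dest: frequently_ex)
    have "real n \<le> real (s n)" using inc_seqs_ge[OF s, of n] by simp
    also have "\<dots> \<le> real (s n) powr \<tau>'"
      using powr_mono[of 1 \<tau>' "real (s n)"] inc_seqs_ge[OF s, of n] n(2) \<open>\<not> \<tau>' < 1\<close> by simp
    finally show False using n(1) by simp
  qed
  with \<tau>' have \<tau>1: "\<tau> \<le> 1" by simp
  define q where "q = power_seq \<tau>"
  have q: "q \<in> inc_seqs" unfolding q_def using \<tau>(1) \<tau>1 by (rule power_seq_in_inc_seqs)
  have q_mono: "strict_mono_on {1..} q" using q by (simp add: inc_seqs_def)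
  have initial: "card (u ` {1..n}) = n" if "strict_mono_on {1..} u" for u :: "nat \<Rightarrow> nat" and n
    using inj_on_subset[OF strict_mono_on_imp_inj_on[OF that], of "{1..n}"]
    by (subst card_image) auto
  define A where "A = s ` {1..} \<union> q ` {1..}"
  have "infinite (s ` {1..})"
    using finite_imageD[OF _ strict_mono_on_imp_inj_on[OF s_mono]] infinite_Ici by blast
  then have inf: "infinite A" by (simp add: A_def)
  have sub: "A \<subseteq> {1..}" using s q by (auto simp: A_def inc_seqs_def)
  define t where "t = seq_of A"
  have t: "t \<in> inc_seqs" unfolding t_def by (rule seq_of_in_inc_seqs[OF inf sub])
  show ?thesis
  proof (rule that[OF t])
    obtain a where a: "0 < ereal a" "ereal a < liminf (\<lambda>n. ereal (h (s ` {1..n}) / real n))"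
      using ereal_dense2[OF pos] by blast
    have ev: "\<forall>\<^sub>F n in sequentially. a < h (s ` {1..n}) / real n"
      using less_LiminfD[OF a(2)] by simp
    have "ereal (a / 3) \<le> limsup (\<lambda>n. ereal (h (t ` {1..n}) / real n))"
    proof (rule ccontr)
      assume "\<not> ?thesis"
      then have "limsup (\<lambda>n. ereal (h (t ` {1..n}) / real n)) < ereal (a / 3)" by simp
      from Limsup_lessD[OF this]
      have "\<forall>\<^sub>F n in sequentially. h (t ` {1..n}) / real n < a / 3" by simp
      then obtain k0 where k0: "\<And>k. k0 \<le> k \<Longrightarrow> h (t ` {1..k}) / real k < a / 3"
        by (auto simp: eventually_sequentially)
      from eventually_conj[OF ev eventually_ge_at_top[of "k0 + 1"]]
      obtain n where n: "real (s n) powr \<tau>' < real n" "a < h (s ` {1..n}) / real n" "k0 + 1 \<le> n"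
        using frequently_eventually_frequently[OF dense] by (auto dest: frequently_ex)
      define k where "k = card (A \<inter> {..s n})"
      have sn: "1 \<le> s n" using inc_seqs_ge[OF s, of n] n by simp
      have s_img: "s ` {1..n} \<subseteq> A \<inter> {..s n}"
        using strict_mono_on_leD[OF s_mono] by (auto simp: A_def)
      have "n \<le> k"
        using card_mono[OF _ s_img] initial[OF s_mono, of n] by (simp add: k_def)
      have "s ` {1..} \<inter> {..s n} \<subseteq> s ` {1..n}"
      proof
        fix x assume "x \<in> s ` {1..} \<inter> {..s n}"
        then obtain i where i: "x = s i" "1 \<le> i" "s i \<le> s n" by auto
        then have "i \<le> n" using strict_mono_onD[OF s_mono, of n i] n(3) by (cases "i \<le> n") auto
        with i show "x \<in> s ` {1..n}" by auto
      qed
      then have "card (s ` {1..} \<inter> {..s n}) \<le> n"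
        using card_mono[of "s ` {1..n}"] initial[OF s_mono, of n] by fastforce
      moreover have "k \<le> card (s ` {1..} \<inter> {..s n}) + card (q ` {1..} \<inter> {..s n})"
        unfolding k_def A_def Int_Un_distrib2 by (rule card_Un_le)
      ultimately have "real k \<le> real n + real (card (q ` {1..} \<inter> {..s n}))" by linarith
      also have "\<dots> \<le> real n + 2 * real (s n) powr \<tau>"
        unfolding q_def using card_power_seq_le[OF \<tau>(1) \<tau>1 sn] by simp
      also have "real (s n) powr \<tau> \<le> real (s n) powr \<tau>'"
        using sn \<tau>' by (intro powr_mono) auto
      finally have "real k \<le> 3 * real n" using n(1) by simp
      then have "a * real k \<le> 3 * (a * real n)" using a by simp
      also have "a * real n \<le> h (s ` {1..n})" using n by (simp add: field_simps)
      also have "\<dots> \<le> h (A \<inter> {..s n})" using s_img by (intro increasing) auto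
      also have "A \<inter> {..s n} = t ` {1..k}"
        unfolding k_def t_def by (rule seq_of_initial[OF inf, symmetric])
      finally have "a / 3 \<le> h (t ` {1..k}) / real k"
        using n(3) \<open>n \<le> k\<close> by (simp add: field_simps)
      with k0[of k] n(3) \<open>n \<le> k\<close> show False by simp
    qed
    moreover have "0 < ereal (a / 3)" using a by simp
    ultimately show "0 < limsup (\<lambda>n. ereal (h (t ` {1..n}) / real n))" by order
    have "\<forall>\<^sub>F m in sequentially. 1 \<le> ereal (real m / real (t m) powr \<tau>)"
      using eventually_ge_at_top[of 1]
    proof eventually_elim
      case (elim m)
      have "q ` {1..m} \<subseteq> A \<inter> {..q m}"
        using strict_mono_on_leD[OF q_mono] by (auto simp: A_def)
      then have "m \<le> card (A \<inter> {..q m})"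
        using card_mono[of "A \<inter> {..q m}" "q ` {1..m}"] initial[OF q_mono, of m] by simp
      then have "t m \<le> q m" unfolding t_def using elim by (intro seq_of_le[OF inf]) auto
      then have "real (t m) powr \<tau> \<le> real (q m) powr \<tau>" using \<tau> by (intro powr_mono2) auto
      also have "\<dots> \<le> real m" unfolding q_def by (rule power_seq_powr_le[OF \<tau>(1)])
      finally show ?case
        using inc_seqs_ge[OF t, of m] elim by (simp add: one_ereal_def)
    qed
    then have lower: "1 \<le> lower_D t \<tau>" unfolding lower_D_def by (rule Liminf_bounded)
    show "ereal \<tau> \<le> lower_dim t"
      unfolding lower_dim_def
    proof (rule INF_greatest)
      fix x assume x: "x \<in> {x. 0 \<le> x \<and> lower_D t x = 0}"
      then have "\<not> x < \<tau>" using lower_D_drop[OF t, of x \<tau>] lower by auto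
      then show "ereal \<tau> \<le> ereal x" by simp
    qed
  qed
qed

end

section \<open>Comparison of the entropy dimensions\<close>

lemma Sup0_upper: "x \<in> A \<Longrightarrow> x \<le> Sup0 A"
  by (auto simp: Sup0_def intro: Sup_upper)

lemma Sup0_least: "0 \<le> b \<Longrightarrow> (\<And>x. x \<in> A \<Longrightarrow> x \<le> b) \<Longrightarrow> Sup0 A \<le> b"
  by (auto simp: Sup0_def intro: Sup_least)

lemma Sup0_nonneg: "(\<And>x. x \<in> A \<Longrightarrow> 0 \<le> x) \<Longrightarrow> 0 \<le> Sup0 A"
  by (auto simp: Sup0_def intro: Sup_upper2)

lemma Sup0_image_mono:
  assumes "\<And>s. s \<in> A \<Longrightarrow> \<exists>t\<in>B. f s \<le> g t" "\<And>t. t \<in> B \<Longrightarrow> 0 \<le> g t"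
  shows "Sup0 (f ` A) \<le> Sup0 (g ` B)"
proof (rule Sup0_least)
  show "0 \<le> Sup0 (g ` B)" using assms(2) by (auto intro: Sup0_nonneg)
  fix x assume "x \<in> f ` A"
  then obtain s where "s \<in> A" "x = f s" by auto
  moreover from assms(1)[OF this(1)] obtain t where "t \<in> B" "f s \<le> g t" by auto
  ultimately show "x \<le> Sup0 (g ` B)" using Sup0_upper[of "g t" "g ` B"] by (auto intro: order_trans)
qed

theorem proposition2p4:
  fixes M :: "'a measure" and T :: "'a \<Rightarrow> 'a" and \<alpha> :: "'a set set"
  assumes "mds M T" and "\<alpha> \<in> fin_meas_partitions M"
  shows "lower_De M T \<alpha> \<le> upper_De M T \<alpha> \<and>
         upper_De M T \<alpha> = lower_Dp M T \<alpha> \<and>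
         lower_Dp M T \<alpha> \<le> upper_Dp M T \<alpha>"
proof -
  interpret mds_partition M T \<alpha>
    using assms by (intro mds_partition.intro mds_partition_axioms.intro)
  interpret submodular_set_function h "2 ^ card \<alpha>"
    using h_mono h_submodular h_empty h_singleton_le by (rule submodular_set_function.intro)
  have E: "entropy_gen_seqs M T \<alpha> =
      {s \<in> inc_seqs. 0 < liminf (\<lambda>n. ereal (h (s ` {1..n}) / real n))}"
    by (simp only: entropy_gen_seqs_def partition_entropy_join)
  have P: "pos_entropy_seqs M T \<alpha> =
      {s \<in> inc_seqs. 0 < limsup (\<lambda>n. ereal (h (s ` {1..n}) / real n))}"
    by (simp only: pos_entropy_seqs_def partition_entropy_join)
  have "lower_De M T \<alpha> \<le> upper_De M T \<alpha>" "lower_Dp M T \<alpha> \<le> upper_Dp M T \<alpha>"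
    unfolding lower_De_def upper_De_def lower_Dp_def upper_Dp_def
    by (intro Sup0_image_mono; use lower_dim_le_upper_dim dims_nonneg in blast)+
  moreover have "lower_Dp M T \<alpha> \<le> upper_De M T \<alpha>"
    unfolding lower_Dp_def upper_De_def
  proof (rule Sup0_image_mono)
    fix s assume "s \<in> pos_entropy_seqs M T \<alpha>"
    then obtain t where "t \<in> entropy_gen_seqs M T \<alpha>" "lower_dim s \<le> upper_dim t"
      unfolding P E using exists_thinning[of s] by blast
    then show "\<exists>t\<in>entropy_gen_seqs M T \<alpha>. lower_dim s \<le> upper_dim t" by blast
  qed (rule dims_nonneg)
  moreover have "upper_De M T \<alpha> \<le> lower_Dp M T \<alpha>"
    unfolding upper_De_def
  proof (rule Sup0_least)
    show nonneg_Dp: "0 \<le> lower_Dp M T \<alpha>"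
      unfolding lower_Dp_def using dims_nonneg by (auto intro: Sup0_nonneg)
    fix x assume "x \<in> upper_dim ` entropy_gen_seqs M T \<alpha>"
    then obtain s where s: "s \<in> entropy_gen_seqs M T \<alpha>" "x = upper_dim s" by auto
    show "x \<le> lower_Dp M T \<alpha>"
    proof (rule ccontr)
      assume "\<not> x \<le> lower_Dp M T \<alpha>"
      then have "lower_Dp M T \<alpha> < upper_dim s" using s(2) by simp
      then obtain \<tau> where \<tau>: "lower_Dp M T \<alpha> < ereal \<tau>" "ereal \<tau> < upper_dim s"
        using ereal_dense2 by blast
      have "0 < ereal \<tau>" using nonneg_Dp \<tau>(1) by order
      then have "0 < \<tau>" by simp
      moreover have "s \<in> inc_seqs" "0 < liminf (\<lambda>n. ereal (h (s ` {1..n}) / real n))"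
        using s(1) by (simp_all add: E)
      ultimately obtain t where t: "t \<in> pos_entropy_seqs M T \<alpha>" "ereal \<tau> \<le> lower_dim t"
        using exists_padding[of s \<tau>] \<tau>(2) by (auto simp: P)
      have "lower_dim t \<le> lower_Dp M T \<alpha>"
        unfolding lower_Dp_def using t(1) by (intro Sup0_upper imageI)
      with t(2) have "ereal \<tau> \<le> lower_Dp M T \<alpha>" by (rule order_trans)
      with \<tau>(1) show False by order
    qed
  qed
  ultimately show ?thesis by auto
qed

end
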